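(* Let $\Theta$ be a nonempty set, let $\pi:\Theta\to(0,1]$ be a prior possibility function, let $y$ be an observation and $\ell(\cdot,y):\Theta\to\mathbb{R}$ a loss such that $m(y)=\inf_{\vartheta\in\Theta}\ell(\vartheta,y)$ is finite, and let $w\ge 0$. Let $$\pi(\theta\,|\,y)=\frac{\exp(-w\,\ell(\theta,y))\,\pi(\theta)}{\sup_{\vartheta\in\Theta}\exp(-w\,\ell(\vartheta,y))\,\pi(\vartheta)},\qquad\theta\in\Theta.$$ For any postdata possibility function $g(\cdot\,|\,y):\Theta\to(0,1]$, let $\Delta_g:\Theta\to\mathbb{R}$ be its information imbalance (defined in the context). Then: (i) (exact conservation) $\Delta_g(\theta)=0$ for all $\theta\in\Theta$ if and only if $g(\theta\,|\,y)=\pi(\theta\,|\,y)$ for all $\theta\in\Theta$; (ii) (no information creation) $\Delta_g(\theta)\ge 0$ for all $\theta\in\Theta$ if and only if $g(\theta\,|\,y)\ge\pi(\theta\,|\,y)$ for all $\theta\in\Theta$; (iii) (no information loss) $\Delta_g(\theta)\le 0$ for all $\theta\in\Theta$ if and only if $g(\theta\,|\,y)\le\pi(\theta\,|\,y)$ for all $\theta\in\Theta$. In particular, $\pi(\cdot\,|\,y)$ is the only postdata possibility function that belongs simultaneously to the no-creation class and the no-loss class.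
   Context: A possibility function on $\Theta$ is a function $f:\Theta\to[0,1]$ with $\sup_{\theta\in\Theta}f(\theta)=1$. The pointwise information of a positive function $f:\Theta\to(0,1]$ is the function $\mathcal{I}[f](\theta)=-\log f(\theta)$; for a constant $c\in(0,1]$, $\mathcal{I}[c]=-\log c$. The evidence possibility at strength $w$ is $L(\theta\,|\,y)=h_y^{w}(\theta)=\exp\big(-w(\ell(\theta,y)-m(y))\big)\in(0,1]$, and the degree of consistency is the constant $c(y)=\sup_{\vartheta\in\Theta}h_y^{w}(\vartheta)\,\pi(\vartheta)\in(0,1]$. An information processing rule outputs a postdata possibility function $g(\cdot\,|\,y)$; its information imbalance is input information minus output information, i.e. the function $$\Delta_g=\big(\mathcal{I}[\pi]+\mathcal{I}[L(\cdot\,|\,y)]\big)-\big(\mathcal{I}[g(\cdot\,|\,y)]+\mathcal{I}[c(y)]\big),$$ that is, $$\Delta_g(\theta)=-\log\pi(\theta)+w\big(\ell(\theta,y)-m(y)\big)+\log g(\theta\,|\,y)+\log c(y).$$ *)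

theory Defs
  imports "HOL-Analysis.Analysis"
begin

text \<open>
  The parameter set is an explicit carrier \<open>\<Theta> :: 'a set\<close>. Functions on it are total HOL
  functions of which only the values on \<open>\<Theta>\<close> are constrained, so equality of functions on
  \<open>\<Theta>\<close> is pointwise equality there. Every supremum and infimum below is taken in \<open>real\<close>; it is
  the genuine one because the sets concerned are nonempty and bounded under the hypotheses
  \<open>\<Theta> \<noteq> {}\<close>, \<open>w \<ge> 0\<close> and \<open>bdd_below\<close> of the losses.
\<close>

definition possibility_function :: "'a set \<Rightarrow> ('a \<Rightarrow> real) \<Rightarrow> bool" where
  "possibility_function \<Theta> f \<longleftrightarrow> f \<in> \<Theta> \<rightarrow> {0..1} \<and> (SUP \<theta>\<in>\<Theta>. f \<theta>) = 1"

definition positive_possibility_function :: "'a set \<Rightarrow> ('a \<Rightarrow> real) \<Rightarrow> bool" where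
  "positive_possibility_function \<Theta> f \<longleftrightarrow> possibility_function \<Theta> f \<and> f \<in> \<Theta> \<rightarrow> {0<..1}"

definition information :: "('a \<Rightarrow> real) \<Rightarrow> 'a \<Rightarrow> real" where
  "information f \<theta> = - ln (f \<theta>)"

definition min_loss :: "'a set \<Rightarrow> ('a \<Rightarrow> 'y \<Rightarrow> real) \<Rightarrow> 'y \<Rightarrow> real" where
  "min_loss \<Theta> l y = (INF \<theta>\<in>\<Theta>. l \<theta> y)"

definition evidence_possibility ::
    "'a set \<Rightarrow> ('a \<Rightarrow> 'y \<Rightarrow> real) \<Rightarrow> real \<Rightarrow> 'y \<Rightarrow> 'a \<Rightarrow> real" where
  "evidence_possibility \<Theta> l w y \<theta> = exp (- w * (l \<theta> y - min_loss \<Theta> l y))"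

definition consistency_degree ::
    "'a set \<Rightarrow> ('a \<Rightarrow> real) \<Rightarrow> ('a \<Rightarrow> 'y \<Rightarrow> real) \<Rightarrow> real \<Rightarrow> 'y \<Rightarrow> real" where
  "consistency_degree \<Theta> p l w y = (SUP \<theta>\<in>\<Theta>. evidence_possibility \<Theta> l w y \<theta> * p \<theta>)"

definition posterior_possibility ::
    "'a set \<Rightarrow> ('a \<Rightarrow> real) \<Rightarrow> ('a \<Rightarrow> 'y \<Rightarrow> real) \<Rightarrow> real \<Rightarrow> 'y \<Rightarrow> 'a \<Rightarrow> real" where
  "posterior_possibility \<Theta> p l w y \<theta> =
     exp (- w * l \<theta> y) * p \<theta> / (SUP \<theta>'\<in>\<Theta>. exp (- w * l \<theta>' y) * p \<theta>')"

definition information_imbalance ::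
    "'a set \<Rightarrow> ('a \<Rightarrow> real) \<Rightarrow> ('a \<Rightarrow> 'y \<Rightarrow> real) \<Rightarrow> real \<Rightarrow> 'y \<Rightarrow> ('a \<Rightarrow> real) \<Rightarrow> 'a \<Rightarrow> real" where
  "information_imbalance \<Theta> p l w y g \<theta> =
     (information p \<theta> + information (evidence_possibility \<Theta> l w y) \<theta>)
     - (information g \<theta> + information (\<lambda>_. consistency_degree \<Theta> p l w y) \<theta>)"

definition no_creation_class ::
    "'a set \<Rightarrow> ('a \<Rightarrow> real) \<Rightarrow> ('a \<Rightarrow> 'y \<Rightarrow> real) \<Rightarrow> real \<Rightarrow> 'y \<Rightarrow> ('a \<Rightarrow> real) set" where
  "no_creation_class \<Theta> p l w y =
     {g. positive_possibility_function \<Theta> g \<and>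
         (\<forall>\<theta>\<in>\<Theta>. information_imbalance \<Theta> p l w y g \<theta> \<ge> 0)}"

definition no_loss_class ::
    "'a set \<Rightarrow> ('a \<Rightarrow> real) \<Rightarrow> ('a \<Rightarrow> 'y \<Rightarrow> real) \<Rightarrow> real \<Rightarrow> 'y \<Rightarrow> ('a \<Rightarrow> real) set" where
  "no_loss_class \<Theta> p l w y =
     {g. positive_possibility_function \<Theta> g \<and>
         (\<forall>\<theta>\<in>\<Theta>. information_imbalance \<Theta> p l w y g \<theta> \<le> 0)}"

end

theory Submission
  imports Defs
begin

text \<open>
  The factor \<open>exp (w * min_loss \<Theta> l y)\<close> in the evidence possibility cancels under
  normalisation, so the posterior is \<open>evidence_possibility * p / consistency_degree\<close>. Taking
  logarithms, the imbalance of \<open>g\<close> is \<open>ln g - ln posterior\<close>, and all claims follow from strict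
  monotonicity of \<open>ln\<close>.
\<close>

text \<open>Serves twice: to pull the constant factor out of the normalising supremum of the
  posterior, and to show that the posterior has supremum 1.\<close>

lemma cSUP_mult_left:
  fixes f :: "'a \<Rightarrow> real"
  assumes "A \<noteq> {}" "bdd_above (f ` A)" "k > 0"
  shows "(SUP x\<in>A. k * f x) = k * (SUP x\<in>A. f x)"
proof -
  obtain B where B: "\<And>x. x \<in> A \<Longrightarrow> f x \<le> B"
    using assms(2) by (auto simp: bdd_above_def)
  have bdd: "bdd_above ((\<lambda>x. k * f x) ` A)"
    by (rule bdd_aboveI2[where M = "k * B"]) (use B assms(3) in auto)
  show ?thesis
  proof (rule antisym)
    show "(SUP x\<in>A. k * f x) \<le> k * (SUP x\<in>A. f x)"
      using assms by (intro cSUP_least mult_left_mono cSUP_upper) auto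
    \<comment> \<open>Dividing by \<open>k > 0\<close> turns the reverse inequality into an upper
      bound for \<open>f\<close> itself, to which the least-upper-bound property applies.\<close>
    have "(SUP x\<in>A. f x) \<le> (SUP x\<in>A. k * f x) / k"
    proof (rule cSUP_least[OF assms(1)])
      fix x assume "x \<in> A"
      then have "k * f x \<le> (SUP x\<in>A. k * f x)"
        by (rule cSUP_upper[OF _ bdd])
      then show "f x \<le> (SUP x\<in>A. k * f x) / k"
        using assms(3) by (simp add: field_simps)
    qed
    then show "k * (SUP x\<in>A. f x) \<le> (SUP x\<in>A. k * f x)"
      using assms(3) by (simp add: field_simps)
  qed
qed

lemma evidence_possibility_pos: "evidence_possibility \<Theta> l w y \<theta> > 0"
  by (simp add: evidence_possibility_def)

text \<open>Boundedness below makes \<open>min_loss\<close> a true lower bound of the losses, so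
  with \<open>w \<ge> 0\<close> the exponent is nonpositive.\<close>

lemma evidence_possibility_le_1:
  assumes "bdd_below ((\<lambda>\<theta>. l \<theta> y) ` \<Theta>)" "w \<ge> 0" "\<theta> \<in> \<Theta>"
  shows "evidence_possibility \<Theta> l w y \<theta> \<le> 1"
proof -
  have "min_loss \<Theta> l y \<le> l \<theta> y"
    unfolding min_loss_def using assms(1,3) by (rule cINF_lower)
  then show ?thesis
    using assms(2) by (simp add: evidence_possibility_def)
qed

context
  fixes \<Theta> :: "'a set" and p :: "'a \<Rightarrow> real" and l :: "'a \<Rightarrow> 'y \<Rightarrow> real"
    and y :: 'y and w :: real
  assumes ne: "\<Theta> \<noteq> {}"
    and prior: "positive_possibility_function \<Theta> p"
    and bdd: "bdd_below ((\<lambda>\<theta>. l \<theta> y) ` \<Theta>)"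
    and w: "w \<ge> 0"
begin

lemma prior_pos: "\<theta> \<in> \<Theta> \<Longrightarrow> p \<theta> > 0"
  and prior_le_1: "\<theta> \<in> \<Theta> \<Longrightarrow> p \<theta> \<le> 1"
  using prior by (auto simp: positive_possibility_function_def)

text \<open>Both factors are at most 1. This bound makes the real-valued \<open>SUP\<close> in
  \<open>consistency_degree\<close> a genuine supremum.\<close>

lemma bdd_above_evidence_times_prior:
  "bdd_above ((\<lambda>\<theta>. evidence_possibility \<Theta> l w y \<theta> * p \<theta>) ` \<Theta>)"
proof (rule bdd_aboveI2[where M = 1])
  fix \<theta> assume "\<theta> \<in> \<Theta>"
  then show "evidence_possibility \<Theta> l w y \<theta> * p \<theta> \<le> 1"
    using evidence_possibility_le_1[where l = l and y = y, OF bdd w] prior_pos[of \<theta>] prior_le_1[of \<theta>]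
    by (intro mult_le_one) auto
qed

lemma evidence_times_prior_le_consistency_degree:
  "\<theta> \<in> \<Theta> \<Longrightarrow> evidence_possibility \<Theta> l w y \<theta> * p \<theta> \<le> consistency_degree \<Theta> p l w y"
  unfolding consistency_degree_def by (rule cSUP_upper[OF _ bdd_above_evidence_times_prior])

text \<open>One point of the carrier suffices: the product there is positive and lies below the
  supremum. Division by the degree and its logarithm both rely on this.\<close>

lemma consistency_degree_pos: "consistency_degree \<Theta> p l w y > 0"
proof -
  obtain \<theta> where "\<theta> \<in> \<Theta>"
    using ne by auto
  then show ?thesis
    using evidence_times_prior_le_consistency_degree[of \<theta>]
      mult_pos_pos[OF evidence_possibility_pos[of \<Theta> l w y \<theta>] prior_pos[of \<theta>]] by linarith
qed

lemma posterior_possibility_eq: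
  "posterior_possibility \<Theta> p l w y \<theta>
     = evidence_possibility \<Theta> l w y \<theta> * p \<theta> / consistency_degree \<Theta> p l w y"
proof -
  let ?k = "exp (- w * min_loss \<Theta> l y)"
  \<comment> \<open>Write \<open>l = m + (l - m)\<close> in the exponent, with \<open>m\<close> the
    minimal loss; the part from \<open>m\<close> is constant in the parameter, so \<open>?k\<close>
    leaves the supremum and cancels in the quotient.\<close>
  have shift: "exp (- w * l \<theta> y) * p \<theta> = ?k * (evidence_possibility \<Theta> l w y \<theta> * p \<theta>)" for \<theta>
    by (simp add: evidence_possibility_def algebra_simps flip: exp_add)
  show ?thesis
    unfolding posterior_possibility_def shift consistency_degree_def
    by (simp add: cSUP_mult_left[OF ne bdd_above_evidence_times_prior])
qed

lemma posterior_possibility_pos: "\<theta> \<in> \<Theta> \<Longrightarrow> posterior_possibility \<Theta> p l w y \<theta> > 0"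
  by (simp add: posterior_possibility_eq evidence_possibility_pos prior_pos consistency_degree_pos)

text \<open>Dividing by the supremum of evidence times prior scales the supremum to 1. Membership of
  the posterior in the two classes requires this.\<close>

lemma positive_possibility_function_posterior:
  "positive_possibility_function \<Theta> (posterior_possibility \<Theta> p l w y)"
proof -
  let ?c = "consistency_degree \<Theta> p l w y"
  have "posterior_possibility \<Theta> p l w y \<theta> \<le> 1" if "\<theta> \<in> \<Theta>" for \<theta>
    using evidence_times_prior_le_consistency_degree[OF that] consistency_degree_pos
    by (simp add: posterior_possibility_eq)
  moreover have "(SUP \<theta>\<in>\<Theta>. posterior_possibility \<Theta> p l w y \<theta>) = 1"
  proof -
    have "(SUP \<theta>\<in>\<Theta>. posterior_possibility \<Theta> p l w y \<theta>)
        = (SUP \<theta>\<in>\<Theta>. inverse ?c * (evidence_possibility \<Theta> l w y \<theta> * p \<theta>))"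
      by (simp add: posterior_possibility_eq divide_inverse mult.commute)
    also have "\<dots> = inverse ?c * ?c"
      using consistency_degree_pos
      by (simp add: cSUP_mult_left[OF ne bdd_above_evidence_times_prior]
          flip: consistency_degree_def)
    finally show ?thesis
      using consistency_degree_pos by simp
  qed
  ultimately show ?thesis
    using posterior_possibility_pos
    by (auto simp: positive_possibility_function_def possibility_function_def less_imp_le)
qed

text \<open>Positivity of prior, evidence and consistency degree lets the logarithm of the posterior
  split into exactly the terms of the imbalance other than \<open>ln (g \<theta>)\<close>.\<close>

lemma information_imbalance_eq:
  assumes "\<theta> \<in> \<Theta>"
  shows "information_imbalance \<Theta> p l w y g \<theta> = ln (g \<theta>) - ln (posterior_possibility \<Theta> p l w y \<theta>)"
  using prior_pos[OF assms] evidence_possibility_pos[of \<Theta> l w y \<theta>] consistency_degree_pos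
  by (simp add: information_imbalance_def information_def posterior_possibility_eq ln_div ln_mult)

text \<open>At a point of the carrier both \<open>g\<close> and the posterior are positive, and on
  positive reals \<open>ln\<close> preserves and reflects equality and order.\<close>

lemma information_imbalance_sign:
  assumes "positive_possibility_function \<Theta> g" "\<theta> \<in> \<Theta>"
  shows "information_imbalance \<Theta> p l w y g \<theta> = 0 \<longleftrightarrow> g \<theta> = posterior_possibility \<Theta> p l w y \<theta>"
    and "information_imbalance \<Theta> p l w y g \<theta> \<ge> 0 \<longleftrightarrow> g \<theta> \<ge> posterior_possibility \<Theta> p l w y \<theta>"
    and "information_imbalance \<Theta> p l w y g \<theta> \<le> 0 \<longleftrightarrow> g \<theta> \<le> posterior_possibility \<Theta> p l w y \<theta>"
proof -
  have "g \<theta> > 0"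
    using assms by (auto simp: positive_possibility_function_def)
  then show "information_imbalance \<Theta> p l w y g \<theta> = 0 \<longleftrightarrow> g \<theta> = posterior_possibility \<Theta> p l w y \<theta>"
    and "information_imbalance \<Theta> p l w y g \<theta> \<ge> 0 \<longleftrightarrow> g \<theta> \<ge> posterior_possibility \<Theta> p l w y \<theta>"
    and "information_imbalance \<Theta> p l w y g \<theta> \<le> 0 \<longleftrightarrow> g \<theta> \<le> posterior_possibility \<Theta> p l w y \<theta>"
    using posterior_possibility_pos[OF assms(2)]
    by (simp_all add: information_imbalance_eq[OF assms(2)])
qed

end

theorem mainTheorem2:
  fixes \<Theta> :: "'a set" and p :: "'a \<Rightarrow> real" and l :: "'a \<Rightarrow> 'y \<Rightarrow> real"
    and y :: 'y and w :: real
  assumes "\<Theta> \<noteq> {}"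
    and "positive_possibility_function \<Theta> p"
    and "bdd_below ((\<lambda>\<theta>. l \<theta> y) ` \<Theta>)"
    and "w \<ge> 0"
  shows "(\<forall>g. positive_possibility_function \<Theta> g \<longrightarrow>
            ((\<forall>\<theta>\<in>\<Theta>. information_imbalance \<Theta> p l w y g \<theta> = 0) \<longleftrightarrow>
             (\<forall>\<theta>\<in>\<Theta>. g \<theta> = posterior_possibility \<Theta> p l w y \<theta>)) \<and>
            ((\<forall>\<theta>\<in>\<Theta>. information_imbalance \<Theta> p l w y g \<theta> \<ge> 0) \<longleftrightarrow>
             (\<forall>\<theta>\<in>\<Theta>. g \<theta> \<ge> posterior_possibility \<Theta> p l w y \<theta>)) \<and>
            ((\<forall>\<theta>\<in>\<Theta>. information_imbalance \<Theta> p l w y g \<theta> \<le> 0) \<longleftrightarrow>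
             (\<forall>\<theta>\<in>\<Theta>. g \<theta> \<le> posterior_possibility \<Theta> p l w y \<theta>)))
       \<and> posterior_possibility \<Theta> p l w y
            \<in> no_creation_class \<Theta> p l w y \<inter> no_loss_class \<Theta> p l w y
       \<and> (\<forall>g \<in> no_creation_class \<Theta> p l w y \<inter> no_loss_class \<Theta> p l w y.
            \<forall>\<theta>\<in>\<Theta>. g \<theta> = posterior_possibility \<Theta> p l w y \<theta>)"
proof -
  note sign = information_imbalance_sign[where l = l and y = y, OF assms]
  note post = positive_possibility_function_posterior[where l = l and y = y, OF assms]
  \<comment> \<open>With the posterior itself as \<open>g\<close>, both sign conditions become
    reflexivity of the order.\<close>
  have "posterior_possibility \<Theta> p l w y \<in> no_creation_class \<Theta> p l w y \<inter> no_loss_class \<Theta> p l w y"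
    using post sign[OF post] by (simp add: no_creation_class_def no_loss_class_def)
  \<comment> \<open>The two classes bound \<open>g\<close> from below and from above by the
    posterior, so antisymmetry gives equality.\<close>
  moreover have "g \<theta> = posterior_possibility \<Theta> p l w y \<theta>"
    if "g \<in> no_creation_class \<Theta> p l w y \<inter> no_loss_class \<Theta> p l w y" "\<theta> \<in> \<Theta>" for g \<theta>
    using that sign[of g \<theta>]
    by (simp add: no_creation_class_def no_loss_class_def)
  ultimately show ?thesis
    \<comment> \<open>The sign equivalences hold at each point, so \<open>ball_cong\<close> lifts
      them to the quantified statements.\<close>
    by (intro conjI allI impI ballI ball_cong refl sign)
qed

end
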